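(* Let $X$ be a centered, nondegenerate, infinitely divisible real random variable with finite variance $V>0$. For every $v>0$ one has $c_*(v)\ge 1/\tau$. Consequently, if the variance-exact pole $c_*(V)$ is boundary controlled, that is, $c_*(V)=1/\tau$, then $c_*(v)=1/\tau$ for every $v\ge V$.
   Context: Standing setting: $X$ is a centered, nondegenerate, infinitely divisible real random variable with variance $0<V=\mathrm{Var}(X)<\infty$, Gaussian variance $a\ge0$ and Lévy measure $\nu$ on $\mathbb{R}\setminus\{0\}$. For all real $t$, $K_X(t)=\log\mathbb{E}e^{tX}=\frac{at^2}{2}+\int_{\mathbb{R}\setminus\{0\}}(e^{tx}-1-tx)\,\nu(dx)\in[0,\infty]$. $\tau=\sup\{t>0:K_X(t)<\infty\}\in[0,\infty]$ (with $\sup\emptyset=0$). Conventions: $1/0=\infty$, $1/\infty=0$. A pair $(v,c)\in(0,\infty)\times[0,\infty)$ is feasible for $X$ if $K_X(t)\le \frac{vt^2}{2(1-ct)}$ for every $0\le t<1/c$ (for $c=0$: for all $t\ge0$). $c_*(v)=\inf\{c\ge0:(v,c)\text{ is feasible}\}\in[0,\infty]$, with $\inf\emptyset=\infty$. Terminology: when $\tau>0$ and $c_*(V)>0$, the variance-exact pole is called boundary controlled if $c_*(V)=1/\tau$. *)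

theory Defs
  imports "HOL-Probability.Probability"
begin

text \<open>The law of \<open>X\<close> is, for every \<open>n \<ge> 1\<close>, the law of a sum of \<open>n\<close> i.i.d. real random variables
  (the coordinates of the \<open>n\<close>-fold product of a probability law \<open>N\<close> on the line).\<close>

definition infinitely_divisible :: "'a measure \<Rightarrow> ('a \<Rightarrow> real) \<Rightarrow> bool" where
  "infinitely_divisible M X \<longleftrightarrow>
     (\<forall>n::nat. n \<ge> 1 \<longrightarrow> (\<exists>N. real_distribution N \<and>
        distr M borel X = distr (\<Pi>\<^sub>M i\<in>{..<n}. N) borel (\<lambda>x. \<Sum>i<n. x i)))"

text \<open>\<open>K\<^sub>X(t) = log E exp(tX)\<close>. The expectation is taken in \<open>[0,\<infinity>]\<close>; it is never \<open>0\<close> on a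
  probability space, so only the value \<open>\<infinity>\<close> has to be separated from the real logarithm.\<close>

definition cgf :: "'a measure \<Rightarrow> ('a \<Rightarrow> real) \<Rightarrow> real \<Rightarrow> ereal" where
  "cgf M X t =
     (let E = \<integral>\<^sup>+\<omega>. ennreal (exp (t * X \<omega>)) \<partial>M
      in if E = \<infinity> then \<infinity> else ereal (ln (enn2real E)))"

text \<open>In \<^typ>\<open>ennreal\<close> one has \<open>Sup {} = 0\<close>, \<open>Inf {} = \<infinity>\<close>, \<open>1 / 0 = \<infinity>\<close> and \<open>1 / \<infinity> = 0\<close>.\<close>

definition cgf_tau :: "'a measure \<Rightarrow> ('a \<Rightarrow> real) \<Rightarrow> ennreal" where
  "cgf_tau M X = Sup {ennreal t |t. t > 0 \<and> cgf M X t < \<infinity>}"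

text \<open>The case \<open>c = 0\<close> is separate because \<open>1 / 0 = 0\<close> in \<^typ>\<open>real\<close>.\<close>

definition feasible :: "'a measure \<Rightarrow> ('a \<Rightarrow> real) \<Rightarrow> real \<Rightarrow> real \<Rightarrow> bool" where
  "feasible M X v c \<longleftrightarrow> v > 0 \<and> c \<ge> 0 \<and>
     (\<forall>t\<ge>0. c = 0 \<or> t < 1 / c \<longrightarrow> cgf M X t \<le> ereal (v * t\<^sup>2 / (2 * (1 - c * t))))"

definition c_star :: "'a measure \<Rightarrow> ('a \<Rightarrow> real) \<Rightarrow> real \<Rightarrow> ennreal" where
  "c_star M X v = Inf {ennreal c |c. c \<ge> 0 \<and> feasible M X v c}"

end

theory Submission
  imports Defs
begin

text \<open>
  A feasible pair \<open>(v, c)\<close> bounds \<open>K\<^sub>X\<close> by a real number at every \<open>0 \<le> t < 1/c\<close>, so \<open>K\<^sub>X\<close> is finite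
  on the whole of this interval. The pole \<open>1/c\<close> of the bound can thus not exceed \<open>\<tau>\<close>, which reads
  \<open>1/\<tau> \<le> c\<close>; the infimum over \<open>c\<close> gives \<open>1/\<tau> \<le> c\<^sub>*(v)\<close>. On the other hand, the bound increases
  with \<open>v\<close>, so \<open>c\<^sub>*\<close> is antitone. If \<open>c\<^sub>*(V)\<close> already equals the lower bound \<open>1/\<tau>\<close>, then \<open>c\<^sub>*(v)\<close> for
  \<open>v \<ge> V\<close> is squeezed between \<open>1/\<tau>\<close> and \<open>c\<^sub>*(V)\<close>.
\<close>

lemma before_pole:
  fixes c t :: real
  assumes "c \<ge> 0" and "c = 0 \<or> t < 1 / c"
  shows "c * t < 1"
  using assms by (cases "c = 0") (auto simp: field_simps)

lemma feasible_imp_cgf_finite: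
  assumes "feasible M X v c" and "t \<ge> 0" and "c = 0 \<or> t < 1 / c"
  shows "cgf M X t < \<infinity>"
proof -
  have "cgf M X t \<le> ereal (v * t\<^sup>2 / (2 * (1 - c * t)))"
    using assms by (auto simp: feasible_def)
  also have "\<dots> < \<infinity>"
    by simp
  finally show ?thesis .
qed

text \<open>All positive reals below \<open>1/c\<close> belong to the set whose supremum is \<open>\<tau>\<close>; since the order on
  the extended half-line is dense, \<open>1/c\<close> itself is at most \<open>\<tau>\<close>. For \<open>c = 0\<close> the same argument runs
  with \<open>1/c = \<infinity>\<close>.\<close>

lemma feasible_imp_pole_le_tau:
  assumes feas: "feasible M X v c"
  shows "1 / ennreal c \<le> cgf_tau M X"
proof (rule dense_le)
  fix y assume y: "y < 1 / ennreal c"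
  have c: "c \<ge> 0"
    using feas by (simp add: feasible_def)
  have "y \<noteq> top"
    using y by auto
  then obtain t where t: "y = ennreal t" "t \<ge> 0"
    by (cases y) auto
  show "y \<le> cgf_tau M X"
  proof (cases "t = 0")
    case False
    have "c = 0 \<or> t < 1 / c"
    proof (cases "c = 0")
      case False
      then have "1 / ennreal c = ennreal (1 / c)"
        using c divide_ennreal[of 1 c] by simp
      then show ?thesis
        using y t c by (simp add: ennreal_less_iff)
    qed simp
    then have "cgf M X t < \<infinity>"
      using feas t by (intro feasible_imp_cgf_finite)
    with False t show ?thesis
      unfolding cgf_tau_def by (intro Sup_upper) force
  qed (use t in simp)
qed

lemma ennreal_inverse_antimono: "x \<le> y \<Longrightarrow> inverse y \<le> inverse (x :: ennreal)"
  by (simp add: less_eq_ennreal.rep_eq inverse_ennreal.rep_eq ereal_inverse_antimono)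

lemma ennreal_inverse_one_divide: "inverse (1 / ennreal c) = ennreal c"
  by (cases "c > 0") (simp_all add: divide_ennreal_def inverse_ennreal ennreal_neg)

lemma inverse_tau_le_c_star: "1 / cgf_tau M X \<le> c_star M X v"
  unfolding c_star_def
proof (rule Inf_greatest, clarify)
  fix c :: real
  assume "feasible M X v c"
  then have "inverse (cgf_tau M X) \<le> inverse (1 / ennreal c)"
    by (intro ennreal_inverse_antimono feasible_imp_pole_le_tau)
  then show "1 / cgf_tau M X \<le> ennreal c"
    by (simp add: ennreal_inverse_one_divide) (simp add: divide_ennreal_def)
qed

lemma feasible_mono:
  assumes "feasible M X v c" and "v \<le> w"
  shows "feasible M X w c"
  unfolding feasible_def
proof (intro conjI allI impI)
  show "w > 0" and c: "c \<ge> 0"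
    using assms by (auto simp: feasible_def)
  fix t :: real
  assume t: "t \<ge> 0" "c = 0 \<or> t < 1 / c"
  have "cgf M X t \<le> ereal (v * t\<^sup>2 / (2 * (1 - c * t)))"
    using assms(1) t by (auto simp: feasible_def)
  also have "v * t\<^sup>2 / (2 * (1 - c * t)) \<le> w * t\<^sup>2 / (2 * (1 - c * t))"
    using before_pole[OF c t(2)] assms(2) by (intro divide_right_mono mult_right_mono) auto
  finally show "cgf M X t \<le> ereal (w * t\<^sup>2 / (2 * (1 - c * t)))"
    by simp
qed

lemma c_star_antimono: "v \<le> w \<Longrightarrow> c_star M X w \<le> c_star M X v"
  unfolding c_star_def by (rule Inf_superset_mono) (use feasible_mono in blast)

theorem proposition4p2:
  fixes M :: "'a measure" and X :: "'a \<Rightarrow> real" and V :: real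
  assumes "prob_space M"
    and "X \<in> borel_measurable M"
    and "infinitely_divisible M X"
    and nondegenerate: "\<not> (\<exists>b. AE \<omega> in M. X \<omega> = b)"
    and "integrable M X"
    and centered: "integral\<^sup>L M X = 0"
    and finite_variance: "integrable M (\<lambda>\<omega>. (X \<omega>)\<^sup>2)"
    and V_eq: "V = prob_space.variance M X"
    and V_pos: "V > 0"
  shows "(\<forall>v>0. c_star M X v \<ge> 1 / cgf_tau M X) \<and>
         (c_star M X V = 1 / cgf_tau M X \<longrightarrow>
            (\<forall>v\<ge>V. c_star M X v = 1 / cgf_tau M X))"
  by (metis antisym c_star_antimono inverse_tau_le_c_star)

end
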